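(* Let $d:\vec{\mathcal{E}}(\mathbb{Z}^n)\to\mathbb{C}\setminus\{0\}$ and let $\alpha:\mathcal{E}(\mathbb{Z}^n)\to\mathbb{C}$ be a map with $\alpha^i\neq0$ and $\alpha^i\neq\alpha^j$ for $i\neq j$. The edge based map $$p:\vec{\mathcal{E}}(\mathbb{Z}^n)\to\mathbb{C}^{2\times2},\qquad p^i=\begin{pmatrix}0&d^i\\-\frac{(\alpha^i)^2}{d^i}&0\end{pmatrix},$$ is an evolvable parallelogram net if and only if $d$ is the edge map of a cross-ratio system with labelling $\alpha$.
   Context: $\mathcal{E}(\mathbb{Z}^n)$ is the set of undirected edges of the lattice $\mathbb{Z}^n$ and $\vec{\mathcal{E}}(\mathbb{Z}^n)$ is the set of directed edges $(x,x+e_i)$, where $x\in\mathbb{Z}^n$ and $e_i$ is the $i$-th unit vector. For an edge based map $p=(p^1,\dots,p^n)$, $p^i(x)$ denotes the value on the edge from $x$ to $x+e_i$; one writes $p^i=p^i(x)$ and $p^i_j=p^i(x+e_j)$, and likewise for $d$ and $\alpha$. For vertex based maps one writes $f=f(x)$, $f_i=f(x+e_i)$, $f_{ij}=f(x+e_i+e_j)$. A parallelogram net with values in a unit associative algebra (here $\mathbb{C}^{2\times2}$) is an edge based map such that on every quad $p^i+p^j_i=p^j+p^i_j$ and $p^j_ip^i=p^i_jp^j$. It is called evolvable if its diagonals $p^j-p^i$ for $i\neq j$ are invertible. The vertex based maps $f:\mathbb{Z}^n\to\mathbb{C}$ considered are assumed throughout to have the four points of each quad pairwise distinct; their edge map is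 $d^i:=f_i-f$. The cross-ratio of four points of $\mathbb{C}$ is $cr(a,b,c,e)=\frac{a-b}{b-c}\frac{c-e}{e-a}$. Such a map $f$ is called a cross-ratio system with labelling $\alpha$ if $\alpha:\mathcal{E}(\mathbb{Z}^n)\to\mathbb{C}$ is an edge labelling, i.e. $\alpha^i_j=\alpha^i$ for $i\neq j$, such that $$cr(f,f_i,f_{ij},f_j)=\frac{d^i d^i_j}{d^j d^j_i}=\frac{(\alpha^i)^2}{(\alpha^j)^2}.$$
   Formalization: For i≠j it is additionally assumed that α^i ≠ −α^j and α^i_j ≠ −α^i; without these the "only if" direction fails, since p depends on α only through its square (e.g. d^1=1, d^2=−1, α^1=1, α^2=−1 gives f_12=f). *)

theory Defs
  imports "HOL-Analysis.Analysis"
begin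

text \<open>
  The lattice \<open>\<int>\<close>^n is \<open>int ^ 'n\<close>. An edge based map is a function \<open>p\<close> of a direction and
  a vertex: \<open>p i x\<close> is the value on the edge from \<open>x\<close> to \<open>x + e i\<close>. Each undirected edge has
  exactly one such representation, so maps on directed and on undirected edges have the same type.
  Thus \<open>p i (x + e j)\<close> is the shifted value written with lower index \<open>j\<close>.
\<close>

definition e :: "'n \<Rightarrow> int ^ 'n" where
  "e i = axis i 1"

text \<open>
  The algebra is that of complex 2x2 matrices; its product is \<open>**\<close>, whereas \<open>*\<close> on this type
  is the entrywise product.
\<close>

definition parallelogram_net :: "('n \<Rightarrow> int ^ 'n \<Rightarrow> complex ^ 2 ^ 2) \<Rightarrow> bool" where
  "parallelogram_net p \<longleftrightarrow>
     (\<forall>i j x. i \<noteq> j \<longrightarrow>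
        p i x + p j (x + e i) = p j x + p i (x + e j) \<and>
        p j (x + e i) ** p i x = p i (x + e j) ** p j x)"

definition evolvable :: "('n \<Rightarrow> int ^ 'n \<Rightarrow> complex ^ 2 ^ 2) \<Rightarrow> bool" where
  "evolvable p \<longleftrightarrow> (\<forall>i j x. i \<noteq> j \<longrightarrow> invertible (p j x - p i x))"

definition quads_distinct :: "(int ^ 'n \<Rightarrow> complex) \<Rightarrow> bool" where
  "quads_distinct f \<longleftrightarrow>
     (\<forall>i j x. i \<noteq> j \<longrightarrow> distinct [f x, f (x + e i), f (x + e i + e j), f (x + e j)])"

definition edge_map :: "(int ^ 'n \<Rightarrow> complex) \<Rightarrow> 'n \<Rightarrow> int ^ 'n \<Rightarrow> complex" where
  "edge_map f i x = f (x + e i) - f x"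

definition cr :: "complex \<Rightarrow> complex \<Rightarrow> complex \<Rightarrow> complex \<Rightarrow> complex" where
  "cr z1 z2 z3 z4 = (z1 - z2) / (z2 - z3) * ((z3 - z4) / (z4 - z1))"

definition edge_labelling :: "('n \<Rightarrow> int ^ 'n \<Rightarrow> complex) \<Rightarrow> bool" where
  "edge_labelling \<alpha> \<longleftrightarrow> (\<forall>i j x. i \<noteq> j \<longrightarrow> \<alpha> i (x + e j) = \<alpha> i x)"

definition cross_ratio_system ::
  "(int ^ 'n \<Rightarrow> complex) \<Rightarrow> ('n \<Rightarrow> int ^ 'n \<Rightarrow> complex) \<Rightarrow> bool" where
  "cross_ratio_system f \<alpha> \<longleftrightarrow>
     quads_distinct f \<and> edge_labelling \<alpha> \<and>
     (\<forall>i j x. i \<noteq> j \<longrightarrow>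
        cr (f x) (f (x + e i)) (f (x + e i + e j)) (f (x + e j)) = (\<alpha> i x)\<^sup>2 / (\<alpha> j x)\<^sup>2)"

text \<open>
  The matrices in the theorem depend on \<open>\<alpha>\<close> only through its square, so the direction from
  nets to cross-ratio systems has to fix signs. The two assumptions \<open>sign_label\<close> and
  \<open>sign_quad\<close> of the theorem do this, and both hold for every cross-ratio system with
  nonzero labelling \<open>\<alpha>\<close>:
  if \<open>\<alpha>\<close> is replaced by \<open>-\<alpha>\<close> on a single edge the net does not change, but \<open>\<alpha>\<close> ceases to
  be an edge labelling (for \<open>n \<ge> 2\<close>); and if \<open>\<alpha> i x = - \<alpha> j x\<close> on a quad of an evolvable
  parallelogram net with \<open>d = edge_map f\<close>, then the opposite vertices \<open>f x\<close> and
  \<open>f (x + e i + e j)\<close> coincide, so \<open>quads_distinct f\<close> fails.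
\<close>

end

theory Submission
  imports Defs
begin

text \<open>
  On a quad put \<open>a = d\<^sup>i\<close>, \<open>c = d\<^sup>j\<close>, \<open>b = d\<^sup>j\<^sub>i\<close>, \<open>g = d\<^sup>i\<^sub>j\<close> and write \<open>A, B, A', B'\<close> for the squared
  labels of the edges \<open>a, c, g, b\<close>. The net equations are \<open>a + b = c + g\<close>, \<open>A/a + B'/b = B/c + A'/g\<close>,
  \<open>bA/a = gB/c\<close> and \<open>B'a/b = A'c/g\<close>. Eliminating \<open>A\<close> and \<open>A'\<close> from the second one leaves
  \<open>(B - B')(a - c) = 0\<close>, and evolvability gives \<open>a \<noteq> c\<close>; so the squares are edge labellings, and
  the third equation is the cross-ratio condition. The first equation says that \<open>d\<close> is a closed
  1-form on the lattice, hence exact.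
\<close>

text \<open>Passing from \<open>m\<close> to \<open>m + 1\<close> either adds the term
  \<open>h m\<close> to the first sum or removes it from the second, which counts negatively. The
  signed sum is thus a discrete antiderivative on all integers.\<close>

lemma int_antiderivative:
  fixes h :: "int \<Rightarrow> 'a::ab_group_add"
  shows "(sum h {0..<m + 1} - sum h {m + 1..<0}) - (sum h {0..<m} - sum h {m..<0}) = h m"
proof (cases "m \<ge> 0")
  case True
  then have "{0..<m + 1} = insert m {0..<m}" by auto
  then show ?thesis using True by simp
next
  case False
  then have "{m..<0} = insert m {m + 1..<0}" by auto
  then show ?thesis using False by simp
qed

text \<open>
  The induction runs over the set \<open>S\<close> of directions in which \<open>f\<close> is already a potential. For a new
  direction \<open>k\<close>, the defect of \<open>f\<close> along \<open>k\<close> is constant in the directions of \<open>S\<close>, so summing it up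
  along \<open>k\<close>-lines, starting from the hyperplane \<open>x $ k = 0\<close>, does not disturb these directions.
\<close>

lemma closed_imp_potential:
  fixes d :: "'n::finite \<Rightarrow> int ^ 'n \<Rightarrow> 'a::ab_group_add"
  assumes closed: "\<And>i j x. i \<noteq> j \<Longrightarrow> d i x + d j (x + e i) = d j x + d i (x + e j)"
  shows "\<exists>f. \<forall>i x. d i x = f (x + e i) - f x"
proof -
  have "\<exists>f. \<forall>i\<in>S. \<forall>x. d i x = f (x + e i) - f x" for S :: "'n set"
    using finite[of S]
  proof (induction S rule: finite_induct)
    case empty
    show ?case by simp
  next
    case (insert k S)
    then obtain f where f: "\<And>i x. i \<in> S \<Longrightarrow> d i x = f (x + e i) - f x" by blast
    define r where "r x = d k x - (f (x + e k) - f x)" for x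
    define line :: "int ^ 'n \<Rightarrow> int \<Rightarrow> int ^ 'n" where "line x l = (\<chi> t. if t = k then l else x $ t)" for x l
    define g where "g x = (\<Sum>l\<in>{0..<x $ k}. r (line x l)) - (\<Sum>l\<in>{x $ k..<0}. r (line x l))" for x
    have r_shift: "r (x + e i) = r x" if "i \<in> S" for i x
    proof -
      have "i \<noteq> k" using that insert.hyps by auto
      then have "d i x + d k (x + e i) = d k x + d i (x + e k)" by (rule closed)
      then show ?thesis
        unfolding r_def using f[OF that, of x] f[OF that, of "x + e k"]
        by (simp add: algebra_simps)
    qed
    have g_S: "g (x + e i) = g x" if "i \<in> S" for i x
    proof -
      have "i \<noteq> k" using that insert.hyps by auto
      then have "(x + e i) $ k = x $ k" "\<And>l. line (x + e i) l = line x l + e i"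
        by (auto simp: line_def e_def axis_def vec_eq_iff)
      then show ?thesis by (simp add: g_def r_shift[OF that])
    qed
    have g_k: "g (x + e k) - g x = r x" for x
    proof -
      have "(x + e k) $ k = x $ k + 1" "\<And>l. line (x + e k) l = line x l"
        and x: "line x (x $ k) = x"
        by (auto simp: line_def e_def axis_def vec_eq_iff)
      then have "g (x + e k) - g x = r (line x (x $ k))"
        using int_antiderivative[of "\<lambda>l. r (line x l)" "x $ k"] by (simp add: g_def)
      with x show ?thesis by simp
    qed
    have "\<forall>i\<in>insert k S. \<forall>x. d i x = (f (x + e i) + g (x + e i)) - (f x + g x)"
    proof (intro ballI allI)
      fix i x
      assume "i \<in> insert k S"
      then consider "i = k" | "i \<in> S" by blast
      then show "d i x = (f (x + e i) + g (x + e i)) - (f x + g x)"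
      proof cases
        case 1
        then show ?thesis using g_k[of x] by (simp add: r_def algebra_simps)
      next
        case 2
        then show ?thesis using f g_S by simp
      qed
    qed
    then show ?case by (intro exI[of _ "\<lambda>x. f x + g x"])
  qed
  from this[of UNIV] show ?thesis by simp
qed

text \<open>The sign is built in so that the matrices of the theorem have \<open>u = d i x\<close>
  and \<open>v = (\<alpha> i x)\<^sup>2 / d i x\<close>.\<close>

definition offdiag :: "'a::field \<Rightarrow> 'a \<Rightarrow> 'a ^ 2 ^ 2" where
  "offdiag u v = vector [vector [0, u], vector [- v, 0]]"

lemma offdiag_add_eq_iff:
  "offdiag u v + offdiag u' v' = offdiag w z + offdiag w' z' \<longleftrightarrow>
    u + u' = w + w' \<and> v + v' = z + z'"
proof -
  have "offdiag u v + offdiag u' v' = offdiag (u + u') (v + v')" for u v u' v' :: 'a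
    by (simp add: offdiag_def vec_eq_iff forall_2)
  moreover have "offdiag u v = offdiag w z \<longleftrightarrow> u = w \<and> v = z" for u v w z :: 'a
    by (auto simp: offdiag_def vec_eq_iff forall_2)
  ultimately show ?thesis by simp
qed

text \<open>The product of two such matrices is diagonal with entries \<open>- (u * v')\<close> and
  \<open>- (v * u')\<close>.\<close>

lemma offdiag_mult_eq_iff:
  "offdiag u v ** offdiag u' v' = offdiag w z ** offdiag w' z' \<longleftrightarrow>
    u * v' = w * z' \<and> v * u' = z * w'"
  by (auto simp: offdiag_def matrix_matrix_mult_def vec_eq_iff forall_2 sum_2)

text \<open>The determinant of the difference is \<open>(u - u') * (v - v')\<close>.\<close>

lemma invertible_offdiag_diff:
  "invertible (offdiag u v - offdiag u' v') \<longleftrightarrow> u \<noteq> u' \<and> v \<noteq> v'"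
  by (auto simp: offdiag_def invertible_det_nz det_2)

text \<open>With \<open>q = a * g / (b * c)\<close> the product equations read
  \<open>A = q * B\<close> and \<open>A' = q * B'\<close>; then all terms of the sum equation have
  the common denominator \<open>b * c\<close>.\<close>

lemma quad_net_iff:
  fixes a b c g A A' B B' :: "'a::field"
  assumes nz: "a \<noteq> 0" "b \<noteq> 0" "c \<noteq> 0" "g \<noteq> 0" "A \<noteq> 0" "B \<noteq> 0"
    and sum: "a + b = c + g"
  shows "A / a + B' / b = B / c + A' / g \<and> b * (A / a) = g * (B / c) \<and> B' / b * a = A' / g * c \<and>
      c \<noteq> a \<and> B / c \<noteq> A / a \<longleftrightarrow>
    A' = A \<and> B' = B \<and> a \<noteq> c \<and> a * g / (b * c) = A / B"
    (is "?L \<longleftrightarrow> ?R")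
proof -
  have A: "b * (A / a) = g * (B / c) \<longleftrightarrow> A = a * g / (b * c) * B"
    and A': "B' / b * a = A' / g * c \<longleftrightarrow> A' = a * g / (b * c) * B'"
    and ratio: "a * g / (b * c) = A / B \<longleftrightarrow> A = a * g / (b * c) * B"
    using nz by (auto simp: divide_simps ac_simps)
  have b: "b = c + g - a"
    using sum by (simp add: eq_diff_eq add.commute)
  show ?thesis
  proof (cases "A = a * g / (b * c) * B \<and> A' = a * g / (b * c) * B'")
    case True
    then have 1: "A / a = g * B / (b * c)" and 2: "A' / g = a * B' / (b * c)"
      using nz by auto
    have 3: "B' / b = c * B' / (b * c)" and 4: "B / c = b * B / (b * c)"
      using nz by auto
    have "A / a + B' / b = B / c + A' / g \<longleftrightarrow>
        (g * B + c * B') / (b * c) = (b * B + a * B') / (b * c)"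
      by (simp only: 1 2 3 4 add_divide_distrib)
    also have "\<dots> \<longleftrightarrow> g * B + c * B' = b * B + a * B'"
      using nz by simp
    also have "\<dots> \<longleftrightarrow> (B - B') * (a - c) = 0"
      unfolding b by (simp add: algebra_simps)
    finally have sum_iff: "A / a + B' / b = B / c + A' / g \<longleftrightarrow> B' = B \<or> a = c"
      by auto
    \<comment> \<open>The second factor of the determinant vanishes exactly when the first
      does.\<close>
    have "B / c = A / a \<longleftrightarrow> b * B / (b * c) = g * B / (b * c)"
      by (simp only: 1 4)
    also have "\<dots> \<longleftrightarrow> b = g"
      using nz by (simp only: divide_cancel_right mult_cancel_right mult_eq_0_iff simp_thms)
    also have "\<dots> \<longleftrightarrow> a = c"
      unfolding b by (auto simp: algebra_simps)
    finally show ?thesis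
      using True sum_iff A A' ratio by auto
  next
    case False
    \<comment> \<open>Each side of the equivalence implies the excluded condition, so both are
      false.\<close>
    then show ?thesis using A A' ratio by auto
  qed
qed

theorem theorem4p2:
  fixes d \<alpha> :: "'n::finite \<Rightarrow> int ^ 'n \<Rightarrow> complex"
    and p :: "'n \<Rightarrow> int ^ 'n \<Rightarrow> complex ^ 2 ^ 2"
  assumes d_nonzero: "\<And>i x. d i x \<noteq> 0"
    and alpha_nonzero: "\<And>i x. \<alpha> i x \<noteq> 0"
    and alpha_distinct: "\<And>i j x. i \<noteq> j \<Longrightarrow> \<alpha> i x \<noteq> \<alpha> j x"
    and sign_label: "\<And>i j x. i \<noteq> j \<Longrightarrow> \<alpha> i (x + e j) \<noteq> - \<alpha> i x"
    and sign_quad: "\<And>i j x. i \<noteq> j \<Longrightarrow> \<alpha> i x \<noteq> - \<alpha> j x"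
    and p_def: "\<And>i x. p i x = vector [vector [0, d i x], vector [- ((\<alpha> i x)\<^sup>2 / d i x), 0]]"
  shows "parallelogram_net p \<and> evolvable p \<longleftrightarrow>
    (\<exists>f. cross_ratio_system f \<alpha> \<and> d = edge_map f)"
proof -
  have p: "p i x = offdiag (d i x) ((\<alpha> i x)\<^sup>2 / d i x)" for i x
    by (simp add: p_def offdiag_def)
  \<comment> \<open>Both sides of the theorem are compared through these three conditions and
    \<open>d i x \<noteq> d j x\<close> on each quad.\<close>
  define closed where
    "closed i j x \<longleftrightarrow> d i x + d j (x + e i) = d j x + d i (x + e j)" for i j x
  define label where
    "label i j x \<longleftrightarrow> \<alpha> i (x + e j) = \<alpha> i x \<and> \<alpha> j (x + e i) = \<alpha> j x" for i j x
  define ratio where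
    "ratio i j x \<longleftrightarrow> d i x * d i (x + e j) / (d j (x + e i) * d j x) = (\<alpha> i x)\<^sup>2 / (\<alpha> j x)\<^sup>2" for i j x
  have "parallelogram_net p \<and> evolvable p \<longleftrightarrow>
      (\<forall>i j x. i \<noteq> j \<longrightarrow> p i x + p j (x + e i) = p j x + p i (x + e j) \<and>
        p j (x + e i) ** p i x = p i (x + e j) ** p j x \<and> invertible (p j x - p i x))"
    unfolding parallelogram_net_def evolvable_def by blast
  also have "\<dots> \<longleftrightarrow>
      (\<forall>i j x. i \<noteq> j \<longrightarrow> closed i j x \<and> label i j x \<and> d i x \<noteq> d j x \<and> ratio i j x)"
  proof -
    have "p i x + p j (x + e i) = p j x + p i (x + e j) \<and>
        p j (x + e i) ** p i x = p i (x + e j) ** p j x \<and> invertible (p j x - p i x) \<longleftrightarrow>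
        closed i j x \<and> label i j x \<and> d i x \<noteq> d j x \<and> ratio i j x"
      (is "?P \<longleftrightarrow> _") if "i \<noteq> j" for i j x
    proof -
      \<comment> \<open>The net sees only squares of labels; \<open>sign_label\<close> rules out the
        negative root.\<close>
      have label: "label i j x \<longleftrightarrow>
          (\<alpha> i (x + e j))\<^sup>2 = (\<alpha> i x)\<^sup>2 \<and> (\<alpha> j (x + e i))\<^sup>2 = (\<alpha> j x)\<^sup>2"
        using sign_label[of i j x] sign_label[of j i x] that by (auto simp: label_def power2_eq_iff)
      have "?P \<longleftrightarrow> closed i j x \<and>
          ((\<alpha> i x)\<^sup>2 / d i x + (\<alpha> j (x + e i))\<^sup>2 / d j (x + e i) =
            (\<alpha> j x)\<^sup>2 / d j x + (\<alpha> i (x + e j))\<^sup>2 / d i (x + e j) \<and>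
           d j (x + e i) * ((\<alpha> i x)\<^sup>2 / d i x) = d i (x + e j) * ((\<alpha> j x)\<^sup>2 / d j x) \<and>
           (\<alpha> j (x + e i))\<^sup>2 / d j (x + e i) * d i x =
            (\<alpha> i (x + e j))\<^sup>2 / d i (x + e j) * d j x \<and>
           d j x \<noteq> d i x \<and> (\<alpha> j x)\<^sup>2 / d j x \<noteq> (\<alpha> i x)\<^sup>2 / d i x)"
        unfolding p offdiag_add_eq_iff offdiag_mult_eq_iff invertible_offdiag_diff closed_def
        by blast
      also have "\<dots> \<longleftrightarrow> closed i j x \<and> label i j x \<and> d i x \<noteq> d j x \<and> ratio i j x"
      proof (cases "closed i j x")
        case True
        then show ?thesis
          unfolding label ratio_def
          using quad_net_iff[of "d i x" "d j (x + e i)" "d j x" "d i (x + e j)"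
              "(\<alpha> i x)\<^sup>2" "(\<alpha> j x)\<^sup>2" "(\<alpha> j (x + e i))\<^sup>2" "(\<alpha> i (x + e j))\<^sup>2"]
          by (simp add: closed_def d_nonzero alpha_nonzero)
      qed simp
      finally show ?thesis .
    qed
    then show ?thesis by blast
  qed
  also have "\<dots> \<longleftrightarrow> (\<exists>f. cross_ratio_system f \<alpha> \<and> d = edge_map f)"
  proof -
    \<comment> \<open>Once a potential \<open>f\<close> is given, \<open>closed\<close> is automatic
      and the other conditions characterize the cross-ratio system.\<close>
    have crs: "cross_ratio_system f \<alpha> \<longleftrightarrow>
        (\<forall>i j x. i \<noteq> j \<longrightarrow> label i j x \<and> d i x \<noteq> d j x \<and> ratio i j x)"
      (is "_ \<longleftrightarrow> (\<forall>i j x. _ \<longrightarrow> ?Q i j x)") and closed: "closed i j x"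
      if d: "d = edge_map f" for f i j x
    proof -
      have swap: "x + e j + e i = x + e i + e j" for i j and x :: "int ^ 'n"
        by (simp add: algebra_simps)
      show closed: "closed i j x" for i j x
        by (simp add: closed_def d edge_map_def swap)
      have f: "f (x + e i) = f x + d i x" for i x
        by (simp add: d edge_map_def)
      have labelling: "edge_labelling \<alpha> \<longleftrightarrow> (\<forall>i j x. i \<noteq> j \<longrightarrow> label i j x)"
        unfolding edge_labelling_def label_def by metis
      have cr: "cr (f x) (f (x + e i)) (f (x + e i + e j)) (f (x + e j)) =
          d i x * d i (x + e j) / (d j (x + e i) * d j x)" for i j x
      proof -
        have "f x + d i x + d j (x + e i) - (f x + d j x) = d i (x + e j)"
          using closed[of i j x] unfolding closed_def by (metis add.assoc add_diff_cancel_left add_diff_cancel_left')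
        then show ?thesis by (simp add: cr_def f)
      qed
      \<comment> \<open>Adjacent vertices differ since \<open>d\<close> is nonzero, and
        \<open>f (x + e i)\<close>, \<open>f (x + e j)\<close> differ iff
        \<open>d i x \<noteq> d j x\<close>. If the other two opposite vertices coincided, the
        cross-ratio would be 1, so the labels would agree up to sign.\<close>
      have distinct: "distinct [f x, f (x + e i), f (x + e i + e j), f (x + e j)] \<longleftrightarrow>
          d i x \<noteq> d j x" if "i \<noteq> j" and ratio: "ratio i j x" for i j x
      proof -
        have "d i x + d j (x + e i) \<noteq> 0"
        proof
          assume 0: "d i x + d j (x + e i) = 0"
          then have b: "d j (x + e i) = - d i x" "d i (x + e j) = - d j x"
            using closed[of i j x] by (auto simp: closed_def add_eq_0_iff)
          then have "(\<alpha> i x)\<^sup>2 / (\<alpha> j x)\<^sup>2 = 1"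
            using ratio d_nonzero[of i x] d_nonzero[of j x] by (simp add: ratio_def)
          then have "(\<alpha> i x)\<^sup>2 = (\<alpha> j x)\<^sup>2"
            using alpha_nonzero[of j x] by simp
          then show False
            using alpha_distinct[OF that(1)] sign_quad[OF that(1)] by (auto simp: power2_eq_iff)
        qed
        moreover have "d i x + d j (x + e i) \<noteq> d j x"
          using closed[of i j x] d_nonzero[of i "x + e j"] by (simp add: closed_def)
        ultimately show ?thesis
          using d_nonzero by (auto simp: f add.assoc[of "f x"])
      qed
      have "cross_ratio_system f \<alpha> \<longleftrightarrow> (\<forall>i j x. i \<noteq> j \<longrightarrow> label i j x \<and>
          distinct [f x, f (x + e i), f (x + e i + e j), f (x + e j)] \<and> ratio i j x)"
        unfolding cross_ratio_system_def quads_distinct_def labelling cr ratio_def by blast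
      then show "cross_ratio_system f \<alpha> \<longleftrightarrow> (\<forall>i j x. i \<noteq> j \<longrightarrow> ?Q i j x)"
        using distinct by metis
    qed
    have "\<exists>f. d = edge_map f" if "\<And>i j x. i \<noteq> j \<Longrightarrow> closed i j x"
    proof -
      have "\<exists>f. \<forall>i x. d i x = f (x + e i) - f x"
        using that by (intro closed_imp_potential) (simp add: closed_def)
      then show ?thesis by (auto simp: edge_map_def fun_eq_iff)
    qed
    with crs closed show ?thesis by metis
  qed
  finally show ?thesis .
qed

end
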